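(* The linked-triangle graph $X_\infty$ is a distance-regular graph with intersection array $(4,2,2,2,\dots;1,1,1,1,\dots)$, i.e. $b_0=4$, $b_1=b_2=b_3=\cdots=2$, $c_1=c_2=c_3=\cdots=1$.
   Context: **Linked-triangle graph.** Start with $X_0=K_3$ (a triangle). Given $X_n$, obtain $X_{n+1}$ by attaching, to each vertex of $X_n$ that lies on only one triangle, a new copy of $K_3$ sharing exactly that vertex (the copies being otherwise disjoint). $X_\infty=(V_\infty,E_\infty)$ is the union of the ascending sequence $X_0\subset X_1\subset\cdots$. Equivalently (up to isomorphism): $V_\infty$ is the set of non-empty finite words in the letters $a,b,c$ in which every two consecutive letters differ, and two distinct words $l_1\cdots l_m$ and $l'_1\cdots l'_n$ are adjacent if and only if either $|m-n|=1$ and $l_i=l'_i$ for $1\le i\le\min\{m,n\}$, or $m=n$ and $l_i=l'_i$ for $1\le i\le m-1$. **Distance-regular graph.** For a connected simple graph $X=(V,E)$ with graph distance $d$, let $\Gamma_i(v)=\{w\in V:d(v,w)=i\}$ and let $\mathrm{diam}(X)\in\mathbb{N}_0\cup\{\infty\}$ be the supremum of distances. $X$ is distance-regular with intersection array $(b_0,b_1,\dots;c_1,c_2,\dots)$ (positive integers) if: $|\Gamma_1(v)|=b_0$ for all $v\in V$; for each $1\le i<\mathrm{diam}(X)$ and all $v,w\in V$ with $d(v,w)=i$, $|\Gamma_{i+1}(v)\cap\Gamma_1(w)|=b_i$ and $|\Gamma_{i-1}(v)\cap\Gamma_1(w)|=c_i$; and, if $s=\mathrm{diam}(X)<\infty$,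 $|\Gamma_{s-1}(v)\cap\Gamma_1(w)|=c_s$ whenever $d(v,w)=s$. *)

theory Defs
  imports "HOL-Library.Ramsey" "HOL-Library.Extended_Nat" "HOL-Library.Disjoint_Sets"
begin

section \<open>Simple graphs and distance-regularity\<close>

text \<open>A graph is a vertex set \<open>V\<close> together with a set \<open>E\<close> of two-element subsets of \<open>V\<close>;
  \<open>V\<close> may be infinite.\<close>

definition simple_graph :: "'a set \<Rightarrow> 'a set set \<Rightarrow> bool" where
  "simple_graph V E \<longleftrightarrow> E \<subseteq> [V]\<^bsup>2\<^esup>"

definition walk_betw :: "'a set \<Rightarrow> 'a set set \<Rightarrow> 'a \<Rightarrow> 'a list \<Rightarrow> 'a \<Rightarrow> bool" where
  "walk_betw V E v p w \<longleftrightarrow>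
     p \<noteq> [] \<and> hd p = v \<and> last p = w \<and> set p \<subseteq> V \<and> successively (\<lambda>x y. {x, y} \<in> E) p"

definition connected_graph :: "'a set \<Rightarrow> 'a set set \<Rightarrow> bool" where
  "connected_graph V E \<longleftrightarrow> V \<noteq> {} \<and> (\<forall>v\<in>V. \<forall>w\<in>V. \<exists>p. walk_betw V E v p w)"

text \<open>A walk with \<open>n\<close> edges is a list of \<open>n + 1\<close> vertices.  The value is meaningful only if
  some walk joins \<open>v\<close> and \<open>w\<close>; it is used for connected graphs only.\<close>

definition gdist :: "'a set \<Rightarrow> 'a set set \<Rightarrow> 'a \<Rightarrow> 'a \<Rightarrow> nat" where
  "gdist V E v w = (LEAST n. \<exists>p. walk_betw V E v p w \<and> length p = Suc n)"

definition sphere_at :: "'a set \<Rightarrow> 'a set set \<Rightarrow> nat \<Rightarrow> 'a \<Rightarrow> 'a set" where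
  "sphere_at V E i v = {w \<in> V. gdist V E v w = i}"

definition graph_diam :: "'a set \<Rightarrow> 'a set set \<Rightarrow> enat" where
  "graph_diam V E = (SUP v\<in>V. SUP w\<in>V. enat (gdist V E v w))"

text \<open>The array is given by functions \<open>b, c\<close> on the naturals.  Only \<open>b 0\<close>, the \<open>b i\<close> with
  \<open>i < diam\<close> and the \<open>c i\<close> with \<open>1 \<le> i \<le> diam\<close> are entries of the array; all other values
  (in particular \<open>c 0\<close>) are unconstrained.  In the last clause \<open>s \<ge> 1\<close> is automatic, since
  \<open>b 0 > 0\<close> forces the existence of an edge.  A positive \<open>card\<close> entails finiteness of the set
  that is counted.\<close>

definition distance_regular ::
  "'a set \<Rightarrow> 'a set set \<Rightarrow> (nat \<Rightarrow> nat) \<Rightarrow> (nat \<Rightarrow> nat) \<Rightarrow> bool" where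
  "distance_regular V E b c \<longleftrightarrow>
     simple_graph V E \<and> connected_graph V E \<and>
     (\<forall>i. i = 0 \<or> enat i < graph_diam V E \<longrightarrow> b i > 0) \<and>
     (\<forall>i. 1 \<le> i \<and> enat i \<le> graph_diam V E \<longrightarrow> c i > 0) \<and>
     (\<forall>v\<in>V. card (sphere_at V E 1 v) = b 0) \<and>
     (\<forall>i. 1 \<le> i \<and> enat i < graph_diam V E \<longrightarrow>
        (\<forall>v\<in>V. \<forall>w\<in>V. gdist V E v w = i \<longrightarrow>
           card (sphere_at V E (i + 1) v \<inter> sphere_at V E 1 w) = b i \<and>
           card (sphere_at V E (i - 1) v \<inter> sphere_at V E 1 w) = c i)) \<and>
     (\<forall>s. graph_diam V E = enat s \<longrightarrow>
        (\<forall>v\<in>V. \<forall>w\<in>V. gdist V E v w = s \<longrightarrow>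
           card (sphere_at V E (s - 1) v \<inter> sphere_at V E 1 w) = c s))"

section \<open>The linked-triangle graph\<close>

definition triangles :: "'a set \<Rightarrow> 'a set set \<Rightarrow> 'a set set" where
  "triangles V E = {T \<in> [V]\<^bsup>3\<^esup>. [T]\<^bsup>2\<^esup> \<subseteq> E}"

definition on_one_triangle :: "'a set \<Rightarrow> 'a set set \<Rightarrow> 'a set" where
  "on_one_triangle V E = {v \<in> V. \<exists>!T. T \<in> triangles V E \<and> v \<in> T}"

text \<open>\<open>N v\<close> consists of the two new vertices of the triangle attached at \<open>v\<close>.\<close>

definition attach_triangles ::
  "'a set \<Rightarrow> 'a set set \<Rightarrow> 'a set \<Rightarrow> 'a set set \<Rightarrow> bool" where
  "attach_triangles V E V' E' \<longleftrightarrow>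
     (\<exists>N. (\<forall>v\<in>on_one_triangle V E. card (N v) = 2 \<and> N v \<inter> V = {}) \<and>
          disjoint_family_on N (on_one_triangle V E) \<and>
          V' = V \<union> (\<Union>v\<in>on_one_triangle V E. N v) \<and>
          E' = E \<union> (\<Union>v\<in>on_one_triangle V E. [insert v (N v)]\<^bsup>2\<^esup>))"

text \<open>The construction determines the graph up to isomorphism only, so being (a copy of) the
  linked-triangle graph is a predicate.\<close>

definition linked_triangle_graph :: "'a set \<Rightarrow> 'a set set \<Rightarrow> bool" where
  "linked_triangle_graph V E \<longleftrightarrow>
     (\<exists>Vs Es. card (Vs 0) = 3 \<and> Es 0 = [Vs 0]\<^bsup>2\<^esup> \<and>
        (\<forall>n::nat. attach_triangles (Vs n) (Es n) (Vs (Suc n)) (Es (Suc n))) \<and>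
        V = (\<Union>n. Vs n) \<and> E = (\<Union>n. Es n))"

section \<open>The model on words\<close>

text \<open>The words in three letters without equal consecutive letters form a linked-triangle graph;
  in particular the predicate is satisfiable.\<close>

datatype letter = La | Lb | Lc

definition words :: "letter list set" where
  "words = {w. w \<noteq> [] \<and> distinct_adj w}"

definition word_adj :: "letter list \<Rightarrow> letter list \<Rightarrow> bool" where
  "word_adj u v \<longleftrightarrow> u \<noteq> v \<and>
     (\<bar>int (length u) - int (length v)\<bar> = 1 \<and>
        (\<forall>i < min (length u) (length v). u ! i = v ! i) \<or>
      length u = length v \<and> (\<forall>i < length u - 1. u ! i = v ! i))"

definition word_edges :: "letter list set set" where
  "word_edges = {{u, v} | u v. u \<in> words \<and> v \<in> words \<and> word_adj u v}"

definition word_triangle :: "letter list \<Rightarrow> letter list set" where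
  "word_triangle p = {w \<in> words. w = p \<or> butlast w = p}"

lemma word_adj_sym: "word_adj u v \<longleftrightarrow> word_adj v u"
  unfolding word_adj_def by (metis abs_minus_commute min.commute)

lemma word_edge_iff: "{u, v} \<in> word_edges \<longleftrightarrow> u \<in> words \<and> v \<in> words \<and> word_adj u v"
  unfolding word_edges_def mem_Collect_eq doubleton_eq_iff using word_adj_sym by blast

lemma word_adj_iff:
  assumes "u \<in> words" "v \<in> words" "length v \<le> length u"
  shows "word_adj u v \<longleftrightarrow> u \<noteq> v \<and> v \<in> word_triangle (butlast u)"
proof -
  have ne: "u \<noteq> []" "v \<noteq> []" using assms by (auto simp: words_def)
  have "\<bar>int (length u) - int (length v)\<bar> = 1 \<longleftrightarrow> length v = length (butlast u)"
    "length u = length v \<longleftrightarrow> length (butlast v) = length (butlast u)"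
    using ne assms(3) by (cases u; cases v; force)+
  then have 1: "\<bar>int (length u) - int (length v)\<bar> = 1 \<and>
      (\<forall>i < min (length u) (length v). u ! i = v ! i) \<longleftrightarrow> v = butlast u"
    and 2: "length u = length v \<and> (\<forall>i < length u - 1. u ! i = v ! i) \<longleftrightarrow> butlast v = butlast u"
    using assms(3) unfolding list_eq_iff_nth_eq by (metis length_butlast min.absorb2 nth_butlast)+
  show ?thesis
    unfolding word_adj_def 1 2 using assms(2) by (auto simp: word_triangle_def)
qed

lemma length_word: "w \<in> words \<Longrightarrow> length w = Suc (length (butlast w))"
  by (cases w rule: rev_cases) (auto simp: words_def)

lemma children: "v \<in> words \<Longrightarrow> {w \<in> words. butlast w = v} = (\<lambda>x. v @ [x]) ` (UNIV - {last v})"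
proof (intro equalityI subsetI)
  fix w assume v: "v \<in> words" and "w \<in> {w \<in> words. butlast w = v}"
  then have w: "w \<in> words" "butlast w = v" by auto
  then obtain x where x: "w = v @ [x]" by (cases w rule: rev_cases) (auto simp: words_def)
  then have "x \<noteq> last v"
    using w(1) v by (auto simp: distinct_adj_append_iff words_def)
  then show "w \<in> (\<lambda>x. v @ [x]) ` (UNIV - {last v})" using x by blast
qed (auto simp: words_def distinct_adj_append_iff)

lemma UNIV_letter: "(UNIV :: letter set) = {La, Lb, Lc}"
  using letter.exhaust by auto

lemma card_children: "v \<in> words \<Longrightarrow> card {w \<in> words. butlast w = v} = 2"
  by (simp add: children card_image inj_on_def)
     (cases "last v"; simp add: UNIV_letter card_Diff_singleton)

lemma roots: "{w \<in> words. butlast w = []} = {[La], [Lb], [Lc]}"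
proof -
  have "w \<in> {[La], [Lb], [Lc]}" if "w \<in> words" "butlast w = []" for w
  proof -
    from that have "w = [last w]" by (metis (mono_tags) append_butlast_last_id append_Nil
      mem_Collect_eq words_def)
    then show ?thesis by (metis (full_types) insertCI letter.exhaust)
  qed
  then show ?thesis by (auto simp: words_def)
qed

lemma word_triangle_Nil: "word_triangle [] = {[La], [Lb], [Lc]}"
  using roots by (auto simp: word_triangle_def words_def)

lemma word_triangle_word:
  "p \<in> words \<Longrightarrow> word_triangle p = insert p {w \<in> words. butlast w = p}"
  by (auto simp: word_triangle_def)

lemma butlast_neq: "w \<in> words \<Longrightarrow> butlast w \<noteq> w"
  by (cases w rule: rev_cases) (auto simp: words_def)

lemma finite_children: "v \<in> words \<Longrightarrow> finite {w \<in> words. butlast w = v}"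
  by (rule card_ge_0_finite) (simp add: card_children)

lemma card_word_triangle: "p = [] \<or> p \<in> words \<Longrightarrow> card (word_triangle p) = 3"
  using butlast_neq
  by (auto simp: word_triangle_Nil word_triangle_word card_insert_if finite_children card_children)

lemma word_triangle_edges: "[word_triangle p]\<^bsup>2\<^esup> \<subseteq> word_edges"
proof
  fix e assume "e \<in> [word_triangle p]\<^bsup>2\<^esup>"
  then obtain u v where e: "e = {u, v}" "u \<noteq> v" "u \<in> word_triangle p" "v \<in> word_triangle p"
    by (elim nsets2_E) auto
  have *: "{x, y} \<in> word_edges"
    if "x \<noteq> y" "x \<in> word_triangle p" "y \<in> word_triangle p" "length y \<le> length x" for x y
  proof -
    have w: "x \<in> words" "y \<in> words" using that by (auto simp: word_triangle_def)
    have "butlast x = p"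
      using that length_word[of y] by (auto simp: word_triangle_def simp del: length_butlast)
    then show ?thesis using w that by (simp add: word_edge_iff word_adj_iff)
  qed
  show "e \<in> word_edges"
    using *[of u v] *[of v u] e by (cases "length v \<le> length u") (auto simp: insert_commute)
qed

definition words_upto :: "nat \<Rightarrow> letter list set" where
  "words_upto n = {w \<in> words. length w \<le> Suc n}"

definition word_edges_upto :: "nat \<Rightarrow> letter list set set" where
  "word_edges_upto n = {e \<in> word_edges. e \<subseteq> words_upto n}"

lemma butlast_word: "w \<in> words \<Longrightarrow> butlast w = [] \<or> butlast w \<in> words"
  by (cases w rule: rev_cases) (auto simp: words_def)

lemma longest_triangle:
  assumes T: "T \<in> triangles (words_upto n) (word_edges_upto n)"
    and u: "u \<in> T" "\<And>v. v \<in> T \<Longrightarrow> length v \<le> length u"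
  shows "T = word_triangle (butlast u)"
proof -
  have fT: "finite T" "card T = 3" "T \<subseteq> words" and E: "[T]\<^bsup>2\<^esup> \<subseteq> word_edges"
    using T by (auto simp: triangles_def nsets_def words_upto_def word_edges_upto_def)
  have "v \<in> word_triangle (butlast u)" if v: "v \<in> T" for v
  proof (cases "v = u")
    case True
    then show ?thesis using fT u by (auto simp: word_triangle_def)
  next
    case False
    then have "{u, v} \<in> word_edges" using E u v by auto
    then show ?thesis using word_adj_iff u(2)[OF v] by (auto simp: word_edge_iff)
  qed
  moreover have "card (word_triangle (butlast u)) = 3"
    using card_word_triangle butlast_word u fT by blast
  ultimately show ?thesis
    using fT by (metis card.infinite card_subset_eq subsetI zero_neq_numeral)
qed

lemma word_triangle_in_triangles:
  assumes "p = [] \<or> p \<in> words" "length p \<le> n"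
  shows "word_triangle p \<in> triangles (words_upto n) (word_edges_upto n)"
proof -
  have c: "card (word_triangle p) = 3" using assms card_word_triangle by blast
  then have f: "finite (word_triangle p)" by (metis card.infinite zero_neq_numeral)
  have s: "word_triangle p \<subseteq> words_upto n"
  proof
    fix x assume "x \<in> word_triangle p"
    then show "x \<in> words_upto n"
      using length_word[of x] assms(2) by (auto simp: word_triangle_def words_upto_def simp del: length_butlast)
  qed
  have "[word_triangle p]\<^bsup>2\<^esup> \<subseteq> word_edges_upto n"
    using word_triangle_edges[of p] s by (auto simp: word_edges_upto_def nsets_def)
  then show ?thesis using c f s by (simp add: triangles_def nsets_def)
qed

lemma on_one_triangle_words:
  "on_one_triangle (words_upto n) (word_edges_upto n) = {w \<in> words. length w = Suc n}"
proof (intro equalityI subsetI)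
  fix w assume "w \<in> on_one_triangle (words_upto n) (word_edges_upto n)"
  then have w: "w \<in> words" "length w \<le> Suc n"
    and one: "\<exists>!T. T \<in> triangles (words_upto n) (word_edges_upto n) \<and> w \<in> T"
    unfolding on_one_triangle_def words_upto_def by blast+
  have "length w = Suc n"
  proof (rule ccontr)
    assume "length w \<noteq> Suc n"
    then have l: "length w \<le> n" using w by simp
    have "word_triangle w \<in> triangles (words_upto n) (word_edges_upto n)"
         "word_triangle (butlast w) \<in> triangles (words_upto n) (word_edges_upto n)"
      using butlast_word[OF w(1)] w(1) l by (auto intro!: word_triangle_in_triangles)
    moreover have "w \<in> word_triangle w" "w \<in> word_triangle (butlast w)"
      using w by (auto simp: word_triangle_def)
    ultimately have eq: "word_triangle w = word_triangle (butlast w)" using one by blast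
    obtain x where x: "x \<in> words" "butlast x = w"
    proof -
      have "{x \<in> words. butlast x = w} \<noteq> {}"
        using card_children[OF w(1)] by (metis card.empty zero_neq_numeral)
      then show thesis using that by blast
    qed
    then have "x \<in> word_triangle w" by (simp add: word_triangle_def)
    then have "x \<in> word_triangle (butlast w)" unfolding eq .
    then have "x = butlast w \<or> butlast x = butlast w" by (auto simp: word_triangle_def)
    then show False
    proof
      assume "x = butlast w"
      then have "length x = length w - 1" by simp
      moreover have "length w = length x - 1" using x(2) by auto
      moreover have "length w > 0" using w by (simp add: words_def)
      ultimately show False by linarith
    next
      assume "butlast x = butlast w"
      then show False using x butlast_neq[OF w(1)] by simp
    qed
  qed
  then show "w \<in> {w \<in> words. length w = Suc n}" using w by simp
next
  fix w assume "w \<in> {w \<in> words. length w = Suc n}"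
  then have w: "w \<in> words" "length w = Suc n" by auto
  have "T = word_triangle (butlast w)"
    if T: "T \<in> triangles (words_upto n) (word_edges_upto n)" "w \<in> T" for T
  proof (rule longest_triangle[OF T])
    fix v assume "v \<in> T"
    then show "length v \<le> length w"
      using T(1) w(2) unfolding triangles_def nsets_def words_upto_def by fastforce
  qed
  moreover have "word_triangle (butlast w) \<in> triangles (words_upto n) (word_edges_upto n)"
    using butlast_word[OF w(1)] w(2) by (intro word_triangle_in_triangles) auto
  moreover have "w \<in> word_triangle (butlast w)" using w by (auto simp: word_triangle_def)
  ultimately have "\<exists>!T. T \<in> triangles (words_upto n) (word_edges_upto n) \<and> w \<in> T"
    by (intro ex1I[of _ "word_triangle (butlast w)"]) blast+
  moreover have "w \<in> words_upto n" using w by (simp add: words_upto_def)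
  ultimately show "w \<in> on_one_triangle (words_upto n) (word_edges_upto n)"
    unfolding on_one_triangle_def by blast
qed

lemma word_edgeE:
  assumes "e \<in> word_edges"
  obtains u where "u \<in> e" "u \<in> words" "e \<in> [word_triangle (butlast u)]\<^bsup>2\<^esup>"
proof -
  have *: "e \<in> [word_triangle (butlast u)]\<^bsup>2\<^esup>"
    if "e = {u, v}" "u \<in> words" "v \<in> words" "word_adj u v" "length v \<le> length u" for u v
    using that word_adj_iff[of u v] by (simp add: word_triangle_def)
  obtain u v where "e = {u, v}" "u \<in> words" "v \<in> words" "word_adj u v"
    using assms by (auto simp: word_edges_def)
  then show thesis
    using *[of u v] *[of v u] that[of u] that[of v] word_adj_sym[of u v]
    by (metis insertCI insert_commute nat_le_linear)
qed

lemma word_triangle_word_edges_Suc: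
  "word_edges_upto (Suc n) =
     word_edges_upto n \<union> (\<Union>v\<in>{w \<in> words. length w = Suc n}. [word_triangle v]\<^bsup>2\<^esup>)"
proof (intro equalityI subsetI)
  fix e assume "e \<in> word_edges_upto (Suc n)"
  then have e: "e \<in> word_edges" "e \<subseteq> words_upto (Suc n)" by (auto simp: word_edges_upto_def)
  obtain u where u: "u \<in> e" "u \<in> words" "e \<in> [word_triangle (butlast u)]\<^bsup>2\<^esup>"
    using e(1) by (rule word_edgeE)
  have lu: "length u \<le> Suc (Suc n)" using u e by (auto simp: words_upto_def)
  show "e \<in> word_edges_upto n \<union> (\<Union>v\<in>{w \<in> words. length w = Suc n}. [word_triangle v]\<^bsup>2\<^esup>)"
  proof (cases "length u = Suc (Suc n)")
    case True
    then have "length (butlast u) = Suc n" by simp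
    moreover from this have "butlast u \<in> words"
      using butlast_word[OF u(2)] by (metis list.size(3) nat.distinct(1))
    ultimately show ?thesis using u by blast
  next
    case False
    then have l: "length (butlast u) \<le> n" using lu by simp
    have "word_triangle (butlast u) \<subseteq> words_upto n"
    proof
      fix x assume "x \<in> word_triangle (butlast u)"
      then show "x \<in> words_upto n"
        using length_word[of x] l by (auto simp: word_triangle_def words_upto_def simp del: length_butlast)
    qed
    then have "e \<subseteq> words_upto n" using u by (auto simp: nsets_def)
    then show ?thesis using e by (simp add: word_edges_upto_def)
  qed
next
  fix e assume "e \<in> word_edges_upto n \<union> (\<Union>v\<in>{w \<in> words. length w = Suc n}. [word_triangle v]\<^bsup>2\<^esup>)"
  then consider "e \<in> word_edges_upto n"
    | v where "v \<in> words" "length v = Suc n" "e \<in> [word_triangle v]\<^bsup>2\<^esup>" by auto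
  then show "e \<in> word_edges_upto (Suc n)"
  proof cases
    case 1
    then show ?thesis unfolding word_edges_upto_def words_upto_def by fastforce
  next
    case 2
    then show ?thesis
      using word_triangle_in_triangles[of v "Suc n"] by (auto simp: triangles_def)
  qed
qed

lemma words_upto_Suc:
  "words_upto (Suc n) =
     words_upto n \<union> (\<Union>v\<in>{w \<in> words. length w = Suc n}. {w \<in> words. butlast w = v})"
proof -
  have "butlast w \<in> words" if "w \<in> words" "length w = Suc (Suc n)" for w
    using butlast_word[OF that(1)] that(2)
    by (metis diff_Suc_1 length_butlast list.size(3) nat.distinct(1))
  then show ?thesis by (auto simp: words_upto_def le_Suc_eq)
qed

theorem linked_triangle_graph_words: "linked_triangle_graph words word_edges"
proof -
  have 0: "words_upto 0 = word_triangle []"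
  proof -
    have "length w \<le> Suc 0 \<longleftrightarrow> butlast w = []" for w :: "letter list"
      by (cases w rule: rev_cases) auto
    then show ?thesis unfolding word_triangle_Nil roots[symmetric] words_upto_def by simp
  qed
  have card_0: "card (words_upto 0) = 3" by (simp add: 0 card_word_triangle)
  have "word_edges_upto 0 \<subseteq> [words_upto 0]\<^bsup>2\<^esup>"
  proof
    fix e assume e: "e \<in> word_edges_upto 0"
    then have "e \<in> word_edges" by (simp add: word_edges_upto_def)
    then obtain u where "e \<in> [word_triangle (butlast u)]\<^bsup>2\<^esup>" by (rule word_edgeE)
    then show "e \<in> [words_upto 0]\<^bsup>2\<^esup>" using e by (auto simp: word_edges_upto_def nsets_def)
  qed
  moreover have "[words_upto 0]\<^bsup>2\<^esup> \<subseteq> word_edges_upto 0"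
    using word_triangle_edges[of "[]"] by (auto simp: 0 word_edges_upto_def nsets_def)
  ultimately have edges_0: "word_edges_upto 0 = [words_upto 0]\<^bsup>2\<^esup>" by blast
  have step: "attach_triangles (words_upto n) (word_edges_upto n)
      (words_upto (Suc n)) (word_edges_upto (Suc n))" for n
  proof -
    let ?S = "{w \<in> words. length w = Suc n}" and ?N = "\<lambda>v. {w \<in> words. butlast w = v}"
    have "card (?N v) = 2 \<and> ?N v \<inter> words_upto n = {}" if "v \<in> ?S" for v
      using that card_children by (auto simp: words_upto_def)
    moreover have "disjoint_family_on ?N ?S" by (auto simp: disjoint_family_on_def)
    moreover have "(\<Union>v\<in>?S. [word_triangle v]\<^bsup>2\<^esup>) = (\<Union>v\<in>?S. [insert v (?N v)]\<^bsup>2\<^esup>)"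
      by (intro SUP_cong refl) (simp only: word_triangle_word mem_Collect_eq)
    moreover from this have "word_edges_upto (Suc n) = word_edges_upto n \<union> (\<Union>v\<in>?S. [insert v (?N v)]\<^bsup>2\<^esup>)"
      by (simp only: word_triangle_word_edges_Suc)
    ultimately show ?thesis
      unfolding attach_triangles_def on_one_triangle_words
      by (intro exI[of _ ?N] conjI ballI words_upto_Suc) simp_all
  qed
  have words_Un: "words = (\<Union>n. words_upto n)" by (auto simp: words_upto_def intro: le_SucI)
  have edges_Un: "word_edges = (\<Union>n. word_edges_upto n)"
  proof (intro equalityI subsetI)
    fix e assume "e \<in> word_edges"
    then obtain u v where e: "e = {u, v}" "u \<in> words" "v \<in> words" "e \<in> word_edges"
      by (auto simp: word_edges_def)
    then have "e \<in> word_edges_upto (max (length u) (length v))"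
      by (auto simp: word_edges_upto_def words_upto_def)
    then show "e \<in> (\<Union>n. word_edges_upto n)" by blast
  qed (auto simp: word_edges_upto_def)
  show ?thesis
    unfolding linked_triangle_graph_def
    by (rule exI[of _ words_upto], rule exI[of _ word_edges_upto])
       (intro conjI allI card_0 edges_0 step words_Un edges_Un)
qed

end

theory Submission
  imports Defs
begin

text \<open>A \<^emph>\<open>level function\<close> at a vertex \<open>v\<close> vanishes at \<open>v\<close>, singles out in every triangle one
  vertex that is nearer to \<open>v\<close> by one than the two others, and makes every \<open>w \<noteq> v\<close> a farther
  vertex of exactly one triangle.  Such a function increases by at most one along edges and every
  \<open>w \<noteq> v\<close> has a neighbour of smaller level, so it is the distance from \<open>v\<close>.  If every vertex lies
  on exactly two triangles, then \<open>w \<noteq> v\<close> has one neighbour nearer to \<open>v\<close> and one equally far in the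
  first triangle, and two farther ones in the second.  Level functions exist: attaching triangles
  extends them uniquely, and from a level function at \<open>p\<close> one at a vertex \<open>v\<close> attached to \<open>p\<close> is
  obtained by keeping the value \<open>1\<close> at its twin and adding one at all vertices other than \<open>v\<close>
  and the twin.\<close>

definition level_function :: "'a set \<Rightarrow> 'a set set \<Rightarrow> 'a \<Rightarrow> ('a \<Rightarrow> nat) \<Rightarrow> bool" where
  "level_function V \<T> v f \<longleftrightarrow> f v = 0 \<and>
     (\<forall>T\<in>\<T>. \<exists>x\<in>T. \<forall>y\<in>T - {x}. f y = Suc (f x)) \<and>
     (\<forall>w\<in>V - {v}. \<exists>!T. T \<in> \<T> \<and> w \<in> T \<and> (\<exists>y\<in>T. f y < f w))"

lemma level_root: "level_function V \<T> v f \<Longrightarrow> f v = 0"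
  by (simp add: level_function_def)

lemma level_nearest:
  "level_function V \<T> v f \<Longrightarrow> T \<in> \<T> \<Longrightarrow> \<exists>x\<in>T. \<forall>y\<in>T - {x}. f y = Suc (f x)"
  by (simp add: level_function_def)

lemma level_farther:
  "level_function V \<T> v f \<Longrightarrow> w \<in> V \<Longrightarrow> w \<noteq> v \<Longrightarrow>
    \<exists>!T. T \<in> \<T> \<and> w \<in> T \<and> (\<exists>y\<in>T. f y < f w)"
  by (simp add: level_function_def)

lemma level_functionI:
  assumes "f v = 0"
    and "\<And>T. T \<in> \<T> \<Longrightarrow> \<exists>x\<in>T. \<forall>y\<in>T - {x}. f y = Suc (f x)"
    and "\<And>w. w \<in> V \<Longrightarrow> w \<noteq> v \<Longrightarrow> \<exists>!T. T \<in> \<T> \<and> w \<in> T \<and> (\<exists>y\<in>T. f y < f w)"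
  shows "level_function V \<T> v f"
  using assms by (simp add: level_function_def)

text \<open>The conditions look at values on \<open>V\<close> only, since the triangles stay inside
  \<open>V\<close>. This lets a level function be replaced by an extension of it, or by a function
  glued together from several stages.\<close>

lemma level_function_cong:
  assumes f: "level_function V \<T> v f" and g: "\<And>x. x \<in> V \<Longrightarrow> g x = f x"
    and v: "v \<in> V" and sub: "\<And>T. T \<in> \<T> \<Longrightarrow> T \<subseteq> V"
  shows "level_function V \<T> v g"
proof (rule level_functionI)
  have eq: "g x = f x" if "x \<in> T" "T \<in> \<T>" for x T
    using g sub that by blast
  show "g v = 0" using g[OF v] level_root[OF f] by simp
  show "\<exists>x\<in>T. \<forall>y\<in>T - {x}. g y = Suc (g x)" if "T \<in> \<T>" for T
    using level_nearest[OF f that] eq[OF _ that] by simp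
  show "\<exists>!T. T \<in> \<T> \<and> w \<in> T \<and> (\<exists>y\<in>T. g y < g w)" if w: "w \<in> V" "w \<noteq> v" for w
  proof -
    have "(\<exists>y\<in>T. g y < g w) \<longleftrightarrow> (\<exists>y\<in>T. f y < f w)" if "T \<in> \<T>" "w \<in> T" for T
      using eq[OF that(2,1)] eq[OF _ that(1)] by simp
    then have "(\<lambda>T. T \<in> \<T> \<and> w \<in> T \<and> (\<exists>y\<in>T. g y < g w)) =
        (\<lambda>T. T \<in> \<T> \<and> w \<in> T \<and> (\<exists>y\<in>T. f y < f w))"
      by (intro ext) blast
    then show ?thesis using level_farther[OF f w] by simp
  qed
qed

section \<open>Distances from level functions\<close>

text \<open>This isolates what the limit graph must provide for counting; the edges are derived from
  the triangles. That two distinct triangles meet in at most one vertex is no axiom here: it follows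
  from the level functions.\<close>

locale triangle_space =
  fixes V :: "'a set" and \<T> :: "'a set set"
  assumes nonempty: "V \<noteq> {}"
    and sub: "T \<in> \<T> \<Longrightarrow> T \<subseteq> V"
    and card3: "T \<in> \<T> \<Longrightarrow> card T = 3"
    and two: "v \<in> V \<Longrightarrow> card {T \<in> \<T>. v \<in> T} = 2"
    and level: "v \<in> V \<Longrightarrow> \<exists>f. level_function V \<T> v f"
begin

definition edges :: "'a set set" where
  "edges = (\<Union>T\<in>\<T>. [T]\<^bsup>2\<^esup>)"

lemma edge_iff: "{x, y} \<in> edges \<longleftrightarrow> x \<noteq> y \<and> (\<exists>T\<in>\<T>. x \<in> T \<and> y \<in> T)"
  by (auto simp: edges_def)

lemma triangle_split:
  assumes "T \<in> \<T>" "x \<in> T"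
  obtains y z where "T = {x, y, z}" "x \<noteq> y" "x \<noteq> z" "y \<noteq> z"
proof -
  have "card (T - {x}) = 2"
    using card3[OF assms(1)] assms(2) by (simp add: card_Diff_singleton)
  then obtain y z where "T - {x} = {y, z}" "y \<noteq> z"
    by (auto simp: card_2_iff)
  then show thesis using that[of y z] assms(2) by blast
qed

text \<open>Of the two triangles through \<open>w\<close> exactly one has a vertex below
  \<open>w\<close>. It supplies the nearer \<open>x\<close> and the equally distant
  \<open>y\<close>; in the other one \<open>w\<close> itself is the nearest vertex, which gives
  \<open>z\<close> and \<open>u\<close>.\<close>

lemma level_split:
  assumes f: "level_function V \<T> v f" and w: "w \<in> V" "w \<noteq> v"
  obtains x y z u where "{a. {a, w} \<in> edges} = {x, y, z, u}" "distinct [x, y, z, u, w]"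
    "f w = Suc (f x)" "f y = f w" "f z = Suc (f w)" "f u = Suc (f w)"
proof -
  have near: "\<exists>x\<in>T. \<forall>y\<in>T - {x}. f y = Suc (f x)" if "T \<in> \<T>" for T
    using level_nearest[OF f that] .
  obtain T where T: "T \<in> \<T>" "w \<in> T" "\<exists>y\<in>T. f y < f w"
    and uniq: "\<And>T'. T' \<in> \<T> \<and> w \<in> T' \<and> (\<exists>y\<in>T'. f y < f w) \<Longrightarrow> T' = T"
    using level_farther[OF f w] by (elim ex1E) metis
  obtain A B where AB: "{T \<in> \<T>. w \<in> T} = {A, B}" "A \<noteq> B"
    using two[OF w(1)] by (meson card_2_iff)
  have "T \<in> {A, B}" using T(1,2) unfolding AB(1)[symmetric] by simp
  then obtain T' where T': "{T \<in> \<T>. w \<in> T} = {T, T'}" "T' \<noteq> T"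
    using AB by (metis insert_commute insertE singletonD)
  have "T' \<in> {T \<in> \<T>. w \<in> T}" unfolding T'(1) by simp
  then have T'2: "T' \<in> \<T>" "w \<in> T'" by simp_all
  then have T'3: "\<not> (\<exists>y\<in>T'. f y < f w)"
    using uniq T'(2) by blast
  obtain x where x: "x \<in> T" "\<forall>y\<in>T - {x}. f y = Suc (f x)" using near[OF T(1)] by blast
  have xw: "x \<noteq> w"
  proof
    assume "x = w"
    obtain y where "y \<in> T" "f y < f w" using T(3) by blast
    then show False using x(2) \<open>x = w\<close> by (cases "y = w") auto
  qed
  obtain y where y: "T = {x, w, y}" "y \<noteq> x" "y \<noteq> w"
  proof -
    obtain a b where "T = {x, a, b}" "x \<noteq> a" "x \<noteq> b" "a \<noteq> b" using triangle_split[OF T(1) x(1)] .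
    then show thesis using T(2) xw that[of a] that[of b] by auto
  qed
  have fx: "f w = Suc (f x)" "f y = f w" using x y xw by auto
  obtain w' where w': "w' \<in> T'" "\<forall>y\<in>T' - {w'}. f y = Suc (f w')" using near[OF T'2(1)] by blast
  \<comment> \<open>Otherwise \<open>w\<close> would be one above \<open>w'\<close>, and the second
    triangle would contain a vertex below \<open>w\<close>.\<close>
  then have "w' = w"
    using T'2(2) T'3 by (metis Diff_iff empty_iff insert_iff lessI)
  obtain z u where zu: "T' = {w, z, u}" "w \<noteq> z" "w \<noteq> u" "z \<noteq> u" using triangle_split[OF T'2] .
  have fz: "f z = Suc (f w)" "f u = Suc (f w)" using w' zu \<open>w' = w\<close> by auto
  have "{a. {a, w} \<in> edges} = (T \<union> T') - {w}"
  proof -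
    have "(\<exists>T\<in>\<T>. a \<in> T \<and> w \<in> T) \<longleftrightarrow> a \<in> T \<union> T'" for a
      using T'(1) by blast
    then show ?thesis by (auto simp: edge_iff)
  qed
  also have "\<dots> = {x, y, z, u}" using y(1,3) zu(1-3) xw by auto
  finally show thesis
  proof (rule that)
    \<comment> \<open>The levels keep \<open>x\<close> and \<open>y\<close> apart from
      \<open>z\<close> and \<open>u\<close>, so the two triangles share only
      \<open>w\<close>.\<close>
    have "f x \<noteq> f z" "f x \<noteq> f u" "f y \<noteq> f z" "f y \<noteq> f u" using fx fz by simp_all
    then show "distinct [x, y, z, u, w]" using xw y(2,3) zu(2-4) by auto
  qed (use fx fz in simp_all)
qed

lemma level_pos:
  assumes "level_function V \<T> v f" "w \<in> V" "w \<noteq> v"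
  shows "f w > 0"
  by (rule level_split[OF assms]) simp

text \<open>On each triangle the level takes just two values, and these are consecutive.\<close>

lemma level_edge:
  assumes "level_function V \<T> v f" "{x, y} \<in> edges"
  shows "f y \<le> Suc (f x)"
proof -
  obtain T where T: "T \<in> \<T>" "x \<in> T" "y \<in> T" using assms(2) by (auto simp: edge_iff)
  then obtain t where "\<forall>y\<in>T - {t}. f y = Suc (f t)"
    using level_nearest[OF assms(1)] by blast
  then have "a = t \<or> f a = Suc (f t)" if "a \<in> T" for a using that by blast
  from this[OF T(2)] this[OF T(3)] show ?thesis by auto
qed

lemma edge_in: "{x, y} \<in> edges \<Longrightarrow> x \<in> V \<and> y \<in> V"
  using sub by (auto simp: edge_iff)

section \<open>The level is the distance from the root\<close>

lemma walk_to_level: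
  assumes f: "level_function V \<T> v f" and v: "v \<in> V"
  shows "w \<in> V \<Longrightarrow> \<exists>p. walk_betw V edges v p w \<and> length p = Suc (f w)"
proof (induction "f w" arbitrary: w)
  case 0
  then have "w = v" using level_pos[OF f] by (metis less_irrefl)
  then show ?case using v 0 by (intro exI[of _ "[v]"]) (auto simp: walk_betw_def)
next
  case (Suc k)
  have "w \<noteq> v" using Suc(2) level_root[OF f] by auto
  obtain x y z u where *: "{a. {a, w} \<in> edges} = {x, y, z, u}" "distinct [x, y, z, u, w]"
    "f w = Suc (f x)" "f y = f w" "f z = Suc (f w)" "f u = Suc (f w)"
    by (rule level_split[OF f Suc(3) \<open>w \<noteq> v\<close>])
  then have e: "{x, w} \<in> edges" by blast
  then obtain p where p: "walk_betw V edges v p x" "length p = Suc (f x)"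
    using Suc(1)[of x] Suc(2) * edge_in by auto
  then have "walk_betw V edges v (p @ [w]) w"
    using e Suc(3) by (auto simp: walk_betw_def successively_append_iff)
  then show ?case using p * by (intro exI[of _ "p @ [w]"]) auto
qed

text \<open>The inequality is strict because \<open>length p\<close> counts vertices, one more than
  the edges along which the level can rise.\<close>

lemma level_le_walk:
  assumes f: "level_function V \<T> v f"
  shows "successively (\<lambda>x y. {x, y} \<in> edges) p \<Longrightarrow> p \<noteq> [] \<Longrightarrow> f (last p) < f (hd p) + length p"
proof (induction p rule: rev_induct)
  case (snoc y p)
  show ?case
  proof (cases "p = []")
    case False
    then have "f (last p) < f (hd p) + length p" "{last p, y} \<in> edges"
      using snoc by (auto simp: successively_append_iff)
    then show ?thesis using level_edge[OF f] False by fastforce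
  qed simp
qed simp

lemma gdist_level:
  assumes f: "level_function V \<T> v f" and v: "v \<in> V" and w: "w \<in> V"
  shows "gdist V edges v w = f w"
  unfolding gdist_def
proof (rule Least_equality)
  show "\<exists>p. walk_betw V edges v p w \<and> length p = Suc (f w)"
    using walk_to_level[OF f v w] .
next
  fix n assume "\<exists>p. walk_betw V edges v p w \<and> length p = Suc n"
  then obtain p where "walk_betw V edges v p w" "length p = Suc n" by blast
  then show "f w \<le> n"
    using level_le_walk[OF f, of p] level_root[OF f] by (auto simp: walk_betw_def)
qed

section \<open>Degrees and intersection numbers\<close>

lemma sphere_1:
  assumes "w \<in> V"
  shows "sphere_at V edges 1 w = {a. {a, w} \<in> edges}"
proof -
  obtain f where f: "level_function V \<T> w f" using level[OF assms] by blast
  have "f a = 1 \<longleftrightarrow> {a, w} \<in> edges" if a: "a \<in> V" for a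
  proof
    assume 1: "f a = 1"
    then have "a \<noteq> w" using level_root[OF f] by auto
    then obtain x where "{x, a} \<in> edges" "f a = Suc (f x)"
      by (rule level_split[OF f a]) blast
    \<comment> \<open>The nearer neighbour of \<open>a\<close> has level 0, and only the root has
      that level.\<close>
    moreover from this have "x = w" using level_pos[OF f] 1 edge_in by fastforce
    ultimately show "{a, w} \<in> edges" by (simp add: insert_commute)
  next
    assume e: "{a, w} \<in> edges"
    then have "a \<noteq> w" by (simp add: edge_iff)
    then have "f a > 0" using level_pos[OF f a] by simp
    moreover have "f a \<le> 1" using level_edge[OF f, of w a] e level_root[OF f]
      by (simp add: insert_commute)
    ultimately show "f a = 1" by simp
  qed
  then show ?thesis
    using gdist_level[OF f assms] edge_in by (auto simp: sphere_at_def)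
qed

lemma sphere_inter:
  assumes f: "level_function V \<T> v f" and "v \<in> V" "w \<in> V"
  shows "sphere_at V edges i v \<inter> sphere_at V edges 1 w = {a. {a, w} \<in> edges \<and> f a = i}"
proof -
  have "sphere_at V edges i v = {a \<in> V. f a = i}"
    using gdist_level[OF f assms(2)] by (auto simp: sphere_at_def)
  then show ?thesis unfolding sphere_1[OF assms(3)] using edge_in by blast
qed

lemma exists_other: "v \<in> V \<Longrightarrow> \<exists>w\<in>V. w \<noteq> v"
proof -
  assume v: "v \<in> V"
  then have "{T \<in> \<T>. v \<in> T} \<noteq> {}" using two by (metis card.empty zero_neq_numeral)
  then obtain T where T: "T \<in> \<T>" "v \<in> T" by blast
  obtain y z where yz: "T = {v, y, z}" "v \<noteq> y" "v \<noteq> z" "y \<noteq> z" using triangle_split[OF T] .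
  have "y \<in> V" using sub[OF T(1)] yz(1) by blast
  then show ?thesis using yz(2) by (intro bexI[of _ y]) simp_all
qed

lemma card_sphere_1:
  assumes w: "w \<in> V"
  shows "card (sphere_at V edges 1 w) = 4"
proof -
  \<comment> \<open>\<open>level_split\<close> describes the neighbours of a vertex other than the
    root, so the degree of \<open>w\<close> is read off from a different root.\<close>
  obtain v where v: "v \<in> V" "v \<noteq> w" using exists_other[OF w] by blast
  obtain f where f: "level_function V \<T> v f" using level[OF v(1)] by blast
  obtain x y z u where *: "{a. {a, w} \<in> edges} = {x, y, z, u}" "distinct [x, y, z, u, w]"
    "f w = Suc (f x)" "f y = f w" "f z = Suc (f w)" "f u = Suc (f w)"
    by (rule level_split[OF f w v(2)[symmetric]])
  show ?thesis unfolding sphere_1[OF w] *(1) using *(2) by simp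
qed

lemma card_sphere_inter:
  assumes v: "v \<in> V" and w: "w \<in> V" and d: "gdist V edges v w = i" "i \<ge> 1"
  shows "card (sphere_at V edges (i + 1) v \<inter> sphere_at V edges 1 w) = 2"
    and "card (sphere_at V edges (i - 1) v \<inter> sphere_at V edges 1 w) = 1"
proof -
  obtain f where f: "level_function V \<T> v f" using level[OF v] by blast
  have i: "f w = i" using d gdist_level[OF f v w] by simp
  then have "w \<noteq> v" using d(2) level_root[OF f] by auto
  obtain x y z u where *: "{a. {a, w} \<in> edges} = {x, y, z, u}" "distinct [x, y, z, u, w]"
    "f w = Suc (f x)" "f y = f w" "f z = Suc (f w)" "f u = Suc (f w)"
    by (rule level_split[OF f w \<open>w \<noteq> v\<close>])
  have "{a. {a, w} \<in> edges \<and> f a = j} = {a \<in> {x, y, z, u}. f a = j}" for j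
    unfolding *(1)[symmetric] by auto
  note inter = sphere_inter[OF f v w, unfolded this]
  have "{a \<in> {x, y, z, u}. f a = i + 1} = {z, u}" using * i by auto
  then show "card (sphere_at V edges (i + 1) v \<inter> sphere_at V edges 1 w) = 2"
    using *(2) by (simp only: inter) simp
  \<comment> \<open>Here \<open>i\<close> is \<open>Suc (f x)\<close>, so the truncated subtraction
    is exact.\<close>
  have "{a \<in> {x, y, z, u}. f a = i - 1} = {x}" using * i by auto
  then show "card (sphere_at V edges (i - 1) v \<inter> sphere_at V edges 1 w) = 1"
    by (simp only: inter) simp
qed

text \<open>A vertex other than the root has a farther neighbour \<open>z\<close>, one level up. At
  the root, where \<open>level_split\<close> does not apply, any neighbour has level 1.\<close>

lemma level_unbounded:
  assumes f: "level_function V \<T> v f" and v: "v \<in> V"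
  shows "\<exists>w\<in>V. f w = n"
proof (induction n)
  case 0
  then show ?case using level_root[OF f] v by blast
next
  case (Suc n)
  then obtain w where w: "w \<in> V" "f w = n" by blast
  show ?case
  proof (cases "w = v")
    case True
    have "card {a. {a, v} \<in> edges} = 4" using card_sphere_1[OF v] sphere_1[OF v] by simp
    then have "{a. {a, v} \<in> edges} \<noteq> {}" by (metis card.empty zero_neq_numeral)
    then obtain a where "{a, v} \<in> edges" by blast
    then have "a \<in> sphere_at V edges 1 v" using sphere_1[OF v] by simp
    then have "a \<in> V" "f a = 1" using gdist_level[OF f v] by (auto simp: sphere_at_def)
    then show ?thesis using True w level_root[OF f] by auto
  next
    case False
    obtain x y z u where *: "{a. {a, w} \<in> edges} = {x, y, z, u}" "distinct [x, y, z, u, w]"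
    "f w = Suc (f x)" "f y = f w" "f z = Suc (f w)" "f u = Suc (f w)"
      by (rule level_split[OF f w(1) False])
    then have "z \<in> V" "f z = Suc n" using w edge_in[of z w] by auto
    then show ?thesis by blast
  qed
qed

lemma graph_diam_edges: "graph_diam V edges = \<infinity>"
proof -
  obtain v where v: "v \<in> V" using nonempty by blast
  obtain f where f: "level_function V \<T> v f" using level[OF v] by blast
  have "enat n \<le> graph_diam V edges" for n
  proof -
    obtain w where w: "w \<in> V" "f w = n" using level_unbounded[OF f v] by blast
    then have "enat n = enat (gdist V edges v w)" using gdist_level[OF f v] by simp
    also have "\<dots> \<le> graph_diam V edges"
      unfolding graph_diam_def by (intro SUP_upper2[OF v] SUP_upper2[OF w(1)]) simp
    finally show ?thesis .
  qed
  then show ?thesis by (metis Suc_ile_eq less_irrefl not_infinity_eq)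
qed

theorem distance_regular_edges:
  "distance_regular V edges (\<lambda>i. if i = 0 then 4 else 2) (\<lambda>i. 1)"
proof -
  have "simple_graph V edges"
    using sub by (auto simp: simple_graph_def edges_def nsets_def)
  moreover have "connected_graph V edges"
    unfolding connected_graph_def using nonempty level walk_to_level by blast
  ultimately show ?thesis
    unfolding distance_regular_def
    using card_sphere_1 card_sphere_inter by (simp add: graph_diam_edges)
qed

end

section \<open>Attaching triangles\<close>

text \<open>One step of the construction, with the set \<open>S\<close> of attaching vertices an
  arbitrary subset of \<open>V\<close>. That \<open>S\<close> consists of the vertices on one
  triangle enters only when the stages are studied.\<close>

locale triangle_attachment =
  fixes V :: "'a set" and E :: "'a set set" and S :: "'a set" and N :: "'a \<Rightarrow> 'a set"
    and V' :: "'a set" and E' :: "'a set set"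
  assumes simple: "E \<subseteq> [V]\<^bsup>2\<^esup>"
    and SV: "S \<subseteq> V"
    and N2: "p \<in> S \<Longrightarrow> card (N p) = 2"
    and N_new: "p \<in> S \<Longrightarrow> N p \<inter> V = {}"
    and disj: "disjoint_family_on N S"
    and V': "V' = V \<union> (\<Union>v\<in>S. N v)"
    and E': "E' = E \<union> (\<Union>v\<in>S. [insert v (N v)]\<^bsup>2\<^esup>)"
begin

lemma N_unique: "y \<in> N p \<Longrightarrow> y \<in> N q \<Longrightarrow> p \<in> S \<Longrightarrow> q \<in> S \<Longrightarrow> p = q"
  using disj by (auto simp: disjoint_family_on_def)

lemma card_new: "p \<in> S \<Longrightarrow> card (insert p (N p)) = 3"
  using N2[of p] N_new[of p] SV card_ge_0_finite[of "N p"]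
  by (subst card_insert_disjoint) auto

lemma simple': "E' \<subseteq> [V']\<^bsup>2\<^esup>"
  using simple SV unfolding E' V' by (auto simp: nsets_def)

text \<open>No unintended triangles arise: an attached triangle meets \<open>V\<close> in a single
  vertex, so it adds no edge between old vertices, and all edges at a new vertex lie in the triangle
  attached with it.\<close>

lemma triangles_attach: "triangles V' E' = triangles V E \<union> (\<lambda>p. insert p (N p)) ` S"
proof (intro equalityI subsetI)
  fix T assume "T \<in> triangles V' E'"
  then have T: "T \<subseteq> V'" "finite T" "card T = 3" "[T]\<^bsup>2\<^esup> \<subseteq> E'"
    by (auto simp: triangles_def nsets_def)
  show "T \<in> triangles V E \<union> (\<lambda>p. insert p (N p)) ` S"
  proof (cases "T \<subseteq> V")
    case True
    have "e \<in> E" if e: "e \<in> [T]\<^bsup>2\<^esup>" for e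
    proof (rule ccontr)
      assume "e \<notin> E"
      then obtain p where p: "p \<in> S" "e \<subseteq> insert p (N p)" "card e = 2"
        using e T(4) unfolding E' by (auto simp: nsets_def)
      have "e \<subseteq> V" using e True by (auto simp: nsets_def)
      then have "e \<subseteq> {p}" using p N_new by blast
      then have "card e \<le> 1" using card_mono[of "{p}" e] by simp
      then show False using p(3) by simp
    qed
    then show ?thesis using True T by (auto simp: triangles_def nsets_def)
  next
    case False
    then obtain y p where y: "y \<in> T" "y \<in> N p" "p \<in> S" "y \<notin> V"
      using T(1) unfolding V' by blast
    have "z \<in> insert p (N p)" if z: "z \<in> T" for z
    proof (cases "z = y")
      case False
      then have "{y, z} \<in> E'" using T(4) z y by auto
      moreover have "{y, z} \<notin> E" using simple y(4) by (auto simp: nsets_def)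
      ultimately obtain q where q: "q \<in> S" "y \<in> insert q (N q)" "z \<in> insert q (N q)"
        unfolding E' by (auto simp: nsets_def)
      \<comment> \<open>As \<open>y\<close> is new, it belongs to \<open>N q\<close> itself, and the
        sets of new vertices are disjoint.\<close>
      then have "q = p" using N_unique y SV by blast
      then show ?thesis using q by simp
    qed (use y in simp)
    moreover have "finite (insert p (N p))"
      using card_new[OF y(3)] by (intro card_ge_0_finite) simp
    ultimately have "T = insert p (N p)"
      using T(3) card_new[OF y(3)] by (intro card_subset_eq) auto
    then show ?thesis using y(3) by blast
  qed
next
  fix T assume "T \<in> triangles V E \<union> (\<lambda>p. insert p (N p)) ` S"
  then show "T \<in> triangles V' E'"
  proof
    assume "T \<in> triangles V E"
    then show ?thesis unfolding V' E' by (auto simp: triangles_def nsets_def)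
  next
    assume "T \<in> (\<lambda>p. insert p (N p)) ` S"
    then obtain p where p: "p \<in> S" "T = insert p (N p)" by blast
    then have "card T = 3" "T \<subseteq> V'"
      using card_new[OF p(1)] SV unfolding V' by auto
    moreover from this have "finite T" by (intro card_ge_0_finite) simp
    ultimately show ?thesis using p unfolding E' by (auto simp: triangles_def nsets_def)
  qed
qed

lemma triangle_sub: "T \<in> triangles V E \<Longrightarrow> T \<subseteq> V"
  by (auto simp: triangles_def nsets_def)

lemma triangle_at_old_iff:
  assumes "v \<in> V"
  shows "T \<in> triangles V' E' \<and> v \<in> T \<longleftrightarrow>
    T \<in> triangles V E \<and> v \<in> T \<or> v \<in> S \<and> T = insert v (N v)"
  using assms N_new unfolding triangles_attach by blast

lemma triangles_at_old:
  assumes "v \<in> V"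
  shows "{T \<in> triangles V' E'. v \<in> T} =
    (if v \<in> S then insert (insert v (N v)) {T \<in> triangles V E. v \<in> T}
     else {T \<in> triangles V E. v \<in> T})"
  using triangle_at_old_iff[OF assms] by auto

lemma triangle_at_new_iff:
  assumes "p \<in> S" "v \<in> N p"
  shows "T \<in> triangles V' E' \<and> v \<in> T \<longleftrightarrow> T = insert p (N p)"
  using assms N_new SV N_unique triangle_sub unfolding triangles_attach by blast

text \<open>This makes the number of triangles at \<open>p\<close> really increase when one is
  attached there.\<close>

lemma new_not_triangle: "p \<in> S \<Longrightarrow> insert p (N p) \<notin> triangles V E"
proof
  assume p: "p \<in> S" and "insert p (N p) \<in> triangles V E"
  then have "N p = {}" using triangle_sub N_new by blast
  then show False using N2[OF p] by simp
qed

section \<open>Level functions after an attachment\<close>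

lemma level_extend:
  assumes f: "level_function V (triangles V E) v f" and v: "v \<in> V"
  obtains f' where "level_function V' (triangles V' E') v f'" "\<And>x. x \<in> V \<Longrightarrow> f' x = f x"
    "\<And>p y. p \<in> S \<Longrightarrow> y \<in> N p \<Longrightarrow> f' y = Suc (f p)"
proof -
  \<comment> \<open>A new vertex gets one more than the level of its attaching vertex, which
    \<open>N_unique\<close> determines.\<close>
  define f' where "f' x = (if x \<in> V then f x else Suc (f (THE p. p \<in> S \<and> x \<in> N p)))" for x
  have old: "f' x = f x" if "x \<in> V" for x using that by (simp add: f'_def)
  have new: "f' y = Suc (f p)" if "p \<in> S" "y \<in> N p" for p y
  proof -
    have "(THE q. q \<in> S \<and> y \<in> N q) = p" using that N_unique by blast
    then show ?thesis using that N_new unfolding f'_def by auto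
  qed
  have F: "level_function V (triangles V E) v f'"
    using f old v triangle_sub by (rule level_function_cong)
  have "\<exists>!T. T \<in> triangles V' E' \<and> w \<in> T \<and> (\<exists>y\<in>T. f' y < f' w)" if w: "w \<in> V'" "w \<noteq> v" for w
  proof (cases "w \<in> V")
    case True
    \<comment> \<open>The triangle attached at an old \<open>w\<close> rises away from
      \<open>w\<close>, so it cannot be a second triangle in which \<open>w\<close> is
      farther.\<close>
    have "\<not> (\<exists>y\<in>insert w (N w). f' y < f' w)" if "w \<in> S"
      using that new[of w] old[OF True] by auto
    then have "(T \<in> triangles V' E' \<and> w \<in> T \<and> (\<exists>y\<in>T. f' y < f' w)) \<longleftrightarrow>
        (T \<in> triangles V E \<and> w \<in> T \<and> (\<exists>y\<in>T. f' y < f' w))" for T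
      using triangle_at_old_iff[OF True, of T] by metis
    then show ?thesis using level_farther[OF F True w(2)] by simp
  next
    case False
    then obtain p where p: "p \<in> S" "w \<in> N p" using w unfolding V' by blast
    have "f' p < f' w" using new[OF p] old p SV by auto
    then show ?thesis using triangle_at_new_iff[OF p]
      by (intro ex1I[of _ "insert p (N p)"]) blast+
  qed
  moreover have "\<exists>x\<in>T. \<forall>y\<in>T - {x}. f' y = Suc (f' x)" if T: "T \<in> triangles V' E'" for T
  proof (cases "T \<in> triangles V E")
    case True
    then show ?thesis using level_nearest[OF F] by blast
  next
    case False
    then obtain p where p: "p \<in> S" "T = insert p (N p)" using T triangles_attach by blast
    then show ?thesis using new[of p] old[of p] SV by auto
  qed
  ultimately have "level_function V' (triangles V' E') v f'"
    using level_root[OF F] by (intro level_functionI)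
  then show thesis using that old new by blast
qed

text \<open>In the enlarged graph \<open>v\<close> and its twin lie on no triangle but
  \<open>insert p (N p)\<close>, so the rest is reached from \<open>v\<close> through
  \<open>p\<close> only. Moving the root from \<open>p\<close> to \<open>v\<close> thus adds one to
  all levels on the other triangles, where comparisons are preserved; only the attached triangle
  needs separate treatment.\<close>

lemma level_at_new:
  assumes f: "level_function V (triangles V E) p f" and p: "p \<in> S" and v: "v \<in> N p"
  shows "\<exists>g. level_function V' (triangles V' E') v g"
proof -
  have pV: "p \<in> V" using p SV by blast
  obtain f' where f': "level_function V' (triangles V' E') p f'"
    and old: "\<And>x. x \<in> V \<Longrightarrow> f' x = f x"
    and new: "\<And>p y. p \<in> S \<Longrightarrow> y \<in> N p \<Longrightarrow> f' y = Suc (f p)"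
    using level_extend[OF f pV] by blast
  have f'p: "f' p = 0" using level_root[OF f'] .
  define g where "g x = (if x = v then 0 else if x \<in> N p then 1 else Suc (f' x))" for x
  have pN: "p \<notin> N p" using N_new[OF p] pV by blast
  have gT: "g x = Suc (f' x)" if "T \<in> triangles V' E'" "T \<noteq> insert p (N p)" "x \<in> T" for T x
  proof -
    have "x \<notin> N p" using triangle_at_new_iff[OF p, of x T] that by blast
    then show ?thesis using v by (auto simp: g_def)
  qed
  have g_p: "g p = 1" and g_v: "g v = 0" and g_N: "y \<in> N p \<Longrightarrow> y \<noteq> v \<Longrightarrow> g y = 1" for y
    using pN v f'p by (auto simp: g_def)
  have "\<exists>x\<in>T. \<forall>y\<in>T - {x}. g y = Suc (g x)" if T: "T \<in> triangles V' E'" for T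
  proof (cases "T = insert p (N p)")
    case True
    then show ?thesis using g_p g_v g_N v by (intro bexI[of _ v]) auto
  next
    case False
    obtain x where "x \<in> T" "\<forall>y\<in>T - {x}. f' y = Suc (f' x)"
      using level_nearest[OF f' T] by blast
    then show ?thesis using gT[OF T False] by (intro bexI[of _ x]) auto
  qed
  moreover have "\<exists>!T. T \<in> triangles V' E' \<and> w \<in> T \<and> (\<exists>y\<in>T. g y < g w)"
    if w: "w \<in> V'" "w \<noteq> v" for w
  proof -
    have T0: "insert p (N p) \<in> triangles V' E'" using triangles_attach p by blast
    consider "w \<in> N p" | "w = p" | "w \<notin> insert p (N p)" by blast
    then show ?thesis
    proof cases
      case 1
      moreover have "g v < g w" using g_v g_N[OF 1 w(2)] by simp
      ultimately show ?thesis using triangle_at_new_iff[OF p 1] v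
        by (intro ex1I[of _ "insert p (N p)"]) blast+
    next
      case 2
      \<comment> \<open>On the other triangles \<open>g\<close> is at least 1, its value at
        \<open>p\<close>, because \<open>p\<close> was the root of \<open>f'\<close>. Hence
        \<open>p\<close> is farther only in the attached triangle.\<close>
      have "\<not> (\<exists>y\<in>T. g y < g p)" if "T \<in> triangles V' E'" "T \<noteq> insert p (N p)" for T
        using gT[OF that] g_p by auto
      moreover have "g v < g p" using g_v g_p by simp
      ultimately show ?thesis using 2 T0 v by (intro ex1I[of _ "insert p (N p)"]) blast+
    next
      case 3
      have "(T \<in> triangles V' E' \<and> w \<in> T \<and> (\<exists>y\<in>T. g y < g w)) \<longleftrightarrow>
        (T \<in> triangles V' E' \<and> w \<in> T \<and> (\<exists>y\<in>T. f' y < f' w))" for T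
      proof (cases "T \<in> triangles V' E' \<and> w \<in> T")
        case True
        then have "T \<in> triangles V' E'" "T \<noteq> insert p (N p)" using 3 by auto
        from gT[OF this] True show ?thesis by simp
      qed blast
      then show ?thesis using level_farther[OF f' w(1)] 3 by simp
    qed
  qed
  ultimately have "level_function V' (triangles V' E') v g"
    using g_v by (intro level_functionI)
  then show ?thesis by blast
qed

end

section \<open>The stages of the construction\<close>

locale linked_triangle_stages =
  fixes Vs :: "nat \<Rightarrow> 'a set" and Es :: "nat \<Rightarrow> 'a set set"
  assumes card_0: "card (Vs 0) = 3" and edges_0: "Es 0 = [Vs 0]\<^bsup>2\<^esup>"
    and step: "attach_triangles (Vs n) (Es n) (Vs (Suc n)) (Es (Suc n))"
begin

abbreviation Ts :: "nat \<Rightarrow> 'a set set" where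
  "Ts n \<equiv> triangles (Vs n) (Es n)"

abbreviation Ss :: "nat \<Rightarrow> 'a set" where
  "Ss n \<equiv> on_one_triangle (Vs n) (Es n)"

abbreviation triangles_at :: "nat \<Rightarrow> 'a \<Rightarrow> 'a set set" where
  "triangles_at n v \<equiv> {T \<in> Ts n. v \<in> T}"

text \<open>Simplicity of the stage is a premise because \<open>simple_stage\<close> is itself
  proved by induction through this lemma.\<close>

lemma attachment:
  assumes "Es n \<subseteq> [Vs n]\<^bsup>2\<^esup>"
  obtains N where "triangle_attachment (Vs n) (Es n) (Ss n) N (Vs (Suc n)) (Es (Suc n))"
proof -
  obtain N where "\<forall>v\<in>Ss n. card (N v) = 2 \<and> N v \<inter> Vs n = {}" "disjoint_family_on N (Ss n)"
    "Vs (Suc n) = Vs n \<union> (\<Union>v\<in>Ss n. N v)"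
    "Es (Suc n) = Es n \<union> (\<Union>v\<in>Ss n. [insert v (N v)]\<^bsup>2\<^esup>)"
    using step[of n] unfolding attach_triangles_def by blast
  moreover have "Ss n \<subseteq> Vs n" by (simp add: on_one_triangle_def)
  ultimately have "triangle_attachment (Vs n) (Es n) (Ss n) N (Vs (Suc n)) (Es (Suc n))"
    using assms by unfold_locales simp_all
  then show thesis by (rule that)
qed

lemma simple_stage: "Es n \<subseteq> [Vs n]\<^bsup>2\<^esup>"
proof (induction n)
  case (Suc n)
  then obtain N where "triangle_attachment (Vs n) (Es n) (Ss n) N (Vs (Suc n)) (Es (Suc n))"
    by (rule attachment)
  then show ?case by (rule triangle_attachment.simple')
qed (simp add: edges_0)

lemma attachment':
  obtains N where "triangle_attachment (Vs n) (Es n) (Ss n) N (Vs (Suc n)) (Es (Suc n))"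
  using attachment[OF simple_stage] .

lemma Ss_iff: "v \<in> Ss n \<longleftrightarrow> v \<in> Vs n \<and> card (triangles_at n v) = 1"
proof -
  have "(\<exists>!T. T \<in> A) \<longleftrightarrow> card A = 1" for A :: "'a set set"
  proof
    assume "\<exists>!T. T \<in> A"
    then obtain T where "T \<in> A" "\<And>T'. T' \<in> A \<Longrightarrow> T' = T" by (elim ex1E) metis
    then have "A = {T}" by blast
    then show "card A = 1" by simp
  next
    assume "card A = 1"
    then show "\<exists>!T. T \<in> A" by (auto simp: card_1_singleton_iff)
  qed
  from this[of "triangles_at n v"] show ?thesis by (simp add: on_one_triangle_def)
qed

lemma triangles_0: "Ts 0 = {Vs 0}"
proof -
  have fin: "finite (Vs 0)" using card_0 by (intro card_ge_0_finite) simp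
  have "T = Vs 0" if "T \<in> Ts 0" for T
    using that card_subset_eq[OF fin, of T] card_0 by (simp add: triangles_def nsets_def)
  moreover have "Vs 0 \<in> Ts 0" using fin card_0 by (simp add: triangles_def nsets_def edges_0)
  ultimately show ?thesis by blast
qed

lemma mono_stage: "m \<le> n \<Longrightarrow> Vs m \<subseteq> Vs n \<and> Es m \<subseteq> Es n \<and> Ts m \<subseteq> Ts n"
proof (induction n rule: dec_induct)
  case (step n)
  obtain N where "triangle_attachment (Vs n) (Es n) (Ss n) N (Vs (Suc n)) (Es (Suc n))"
    by (rule attachment')
  then interpret triangle_attachment "Vs n" "Es n" "Ss n" N "Vs (Suc n)" "Es (Suc n)" .
  show ?case using step V' E' triangles_attach by blast
qed simp

text \<open>Every edge lies in a triangle, so the union of the stages has the edge set that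
  \<open>triangle_space\<close> derives from its triangles.\<close>

lemma edges_stage: "Es n = (\<Union>T\<in>Ts n. [T]\<^bsup>2\<^esup>)"
proof (induction n)
  case (Suc n)
  obtain N where "triangle_attachment (Vs n) (Es n) (Ss n) N (Vs (Suc n)) (Es (Suc n))"
    by (rule attachment')
  then interpret triangle_attachment "Vs n" "Es n" "Ss n" N "Vs (Suc n)" "Es (Suc n)" .
  have "(\<Union>T\<in>Ts (Suc n). [T]\<^bsup>2\<^esup>) =
      (\<Union>T\<in>Ts n. [T]\<^bsup>2\<^esup>) \<union> (\<Union>v\<in>Ss n. [insert v (N v)]\<^bsup>2\<^esup>)"
    unfolding triangles_attach by blast
  then show ?case using E' Suc by simp
next
  case 0
  show ?case unfolding triangles_0 by (simp add: edges_0)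
qed

section \<open>The number of triangles at a vertex\<close>

lemma card_at: "v \<in> Vs n \<Longrightarrow> card (triangles_at n v) = 1 \<or> card (triangles_at n v) = 2"
proof (induction n)
  case (Suc n)
  obtain N where "triangle_attachment (Vs n) (Es n) (Ss n) N (Vs (Suc n)) (Es (Suc n))"
    by (rule attachment')
  then interpret triangle_attachment "Vs n" "Es n" "Ss n" N "Vs (Suc n)" "Es (Suc n)" .
  consider p where "p \<in> Ss n" "v \<in> N p" | "v \<in> Vs n" "v \<in> Ss n" | "v \<in> Vs n" "v \<notin> Ss n"
    using Suc(2) V' by blast
  then show ?case
  proof cases
    case 1
    then show ?thesis using triangle_at_new_iff by simp
  next
    case 2
    then obtain T where "triangles_at n v = {T}" using Ss_iff by (auto simp: card_1_singleton_iff)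
    then show ?thesis using triangles_at_old[OF 2(1)] 2(2) by (simp add: card_insert_if)
  next
    case 3
    then show ?thesis using triangles_at_old[OF 3(1)] Suc(1) by simp
  qed
next
  case 0
  then have "triangles_at 0 v = {Vs 0}" by (auto simp: triangles_0)
  then show ?case by simp
qed

text \<open>A vertex on two triangles is not in \<open>Ss\<close>, so nothing is attached to it at
  the next step; this state persists.\<close>

lemma at_complete:
  assumes v: "v \<in> Vs n" and c: "card (triangles_at n v) = 2"
  shows "n \<le> m \<Longrightarrow> triangles_at m v = triangles_at n v"
proof (induction m rule: dec_induct)
  case (step m)
  obtain N where "triangle_attachment (Vs m) (Es m) (Ss m) N (Vs (Suc m)) (Es (Suc m))"
    by (rule attachment')
  then interpret triangle_attachment "Vs m" "Es m" "Ss m" N "Vs (Suc m)" "Es (Suc m)" .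
  have "v \<in> Vs m" using mono_stage[OF step(1)] v by blast
  moreover have "v \<notin> Ss m" using Ss_iff c step by simp
  ultimately show ?case using triangles_at_old step by simp
qed simp

lemma eventually_two:
  assumes v: "v \<in> Vs n"
  shows "\<exists>m. v \<in> Vs m \<and> card (triangles_at m v) = 2"
proof (cases "v \<in> Ss n")
  case False
  then show ?thesis using card_at[OF v] Ss_iff v by blast
next
  case True
  obtain N where "triangle_attachment (Vs n) (Es n) (Ss n) N (Vs (Suc n)) (Es (Suc n))"
    by (rule attachment')
  then interpret triangle_attachment "Vs n" "Es n" "Ss n" N "Vs (Suc n)" "Es (Suc n)" .
  obtain T where T: "triangles_at n v = {T}" using Ss_iff True by (auto simp: card_1_singleton_iff)
  have "insert v (N v) \<noteq> T" using T new_not_triangle[OF True] by blast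
  then have "card (triangles_at (Suc n) v) = 2" using triangles_at_old[OF v] True T by simp
  then show ?thesis using V' v by blast
qed

section \<open>Level functions on the stages and on their union\<close>

lemma level_stage: "v \<in> Vs n \<Longrightarrow> \<exists>f. level_function (Vs n) (Ts n) v f"
proof (induction n arbitrary: v)
  case 0
  have "level_function (Vs 0) (Ts 0) v (\<lambda>x. if x = v then 0 else 1)"
    using 0 by (auto simp: triangles_0 intro!: level_functionI)
  then show ?case by blast
next
  case (Suc n)
  obtain N where "triangle_attachment (Vs n) (Es n) (Ss n) N (Vs (Suc n)) (Es (Suc n))"
    by (rule attachment')
  then interpret triangle_attachment "Vs n" "Es n" "Ss n" N "Vs (Suc n)" "Es (Suc n)" .
  show ?case
  proof (cases "v \<in> Vs n")
    case True
    then show ?thesis using Suc(1) level_extend by metis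
  next
    case False
    \<comment> \<open>A new vertex borrows the level function of its attaching vertex, which is why
      the induction ranges over all roots.\<close>
    then obtain p where p: "p \<in> Ss n" "v \<in> N p" using Suc(2) V' by blast
    then obtain f where "level_function (Vs n) (Ts n) p f" using Suc(1)[of p] SV by blast
    then show ?thesis using level_at_new p by blast
  qed
qed

text \<open>Independently chosen level functions of the stages need not be known to agree, so each
  is chosen as an extension of the previous one, starting at a stage that contains \<open>v\<close>.
  The conditions pass to the union because each of them concerns a vertex and at most two triangles
  at a time.\<close>

lemma level_limit:
  assumes v: "v \<in> Vs n"
  shows "\<exists>f. level_function (\<Union>n. Vs n) (\<Union>n. Ts n) v f"
proof -
  have vn: "v \<in> Vs (n + k)" for k using mono_stage[of n "n + k"] v by auto
  have "\<exists>g. \<forall>k. level_function (Vs (n + k)) (Ts (n + k)) v (g k) \<and>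
      (\<forall>x\<in>Vs (n + k). g (Suc k) x = g k x)"
  proof (rule dependent_nat_choice)
    show "\<exists>f. level_function (Vs (n + 0)) (Ts (n + 0)) v f" using level_stage v by simp
  next
    fix f k assume f: "level_function (Vs (n + k)) (Ts (n + k)) v f"
    obtain N where "triangle_attachment (Vs (n + k)) (Es (n + k)) (Ss (n + k)) N
        (Vs (Suc (n + k))) (Es (Suc (n + k)))"
      by (rule attachment')
    then show "\<exists>f'. level_function (Vs (n + Suc k)) (Ts (n + Suc k)) v f' \<and>
        (\<forall>x\<in>Vs (n + k). f' x = f x)"
      using triangle_attachment.level_extend[OF _ f vn] by (metis add_Suc_right)
  qed
  then obtain g where g: "\<And>k. level_function (Vs (n + k)) (Ts (n + k)) v (g k)"
    and g_Suc: "\<And>k x. x \<in> Vs (n + k) \<Longrightarrow> g (Suc k) x = g k x" by blast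
  have g_le: "k \<le> l \<Longrightarrow> x \<in> Vs (n + k) \<Longrightarrow> g l x = g k x" for k l x
  proof (induction l rule: dec_induct)
    case (step l)
    then have "x \<in> Vs (n + l)" using mono_stage[of "n + k" "n + l"] by auto
    then show ?case using g_Suc step by simp
  qed simp
  \<comment> \<open>The least stage is only a representative: by \<open>g_le\<close> every later
    stage gives the same value.\<close>
  define f where "f x = g (LEAST k. x \<in> Vs (n + k)) x" for x
  have fg: "f x = g k x" if "x \<in> Vs (n + k)" for x k
    unfolding f_def using g_le[of "LEAST k. x \<in> Vs (n + k)" k x] that
    by (metis (mono_tags, lifting) LeastI Least_le)
  have f: "level_function (Vs (n + k)) (Ts (n + k)) v f" for k
    using g fg vn by (rule level_function_cong) (auto simp: triangles_def nsets_def)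
  \<comment> \<open>Uniqueness in the union compares two triangles through a vertex that may come
    from different stages; this moves all three into one stage from \<open>n\<close> on.\<close>
  have common: "\<exists>k. a \<in> Vs (n + k) \<and> T \<in> Ts (n + k) \<and> T' \<in> Ts (n + k)"
    if "a \<in> Vs i" "T \<in> Ts j" "T' \<in> Ts l" for a T T' i j l
    using that mono_stage[of i "n + (i + j + l)"] mono_stage[of j "n + (i + j + l)"]
      mono_stage[of l "n + (i + j + l)"] by (intro exI[of _ "i + j + l"]) auto
  have "\<exists>x\<in>T. \<forall>y\<in>T - {x}. f y = Suc (f x)" if T: "T \<in> (\<Union>n. Ts n)" for T
  proof -
    obtain j where "T \<in> Ts j" using T by blast
    from common[OF v this this] obtain k where "T \<in> Ts (n + k)" by blast
    then show ?thesis using level_nearest[OF f] by blast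
  qed
  moreover have "\<exists>!T. T \<in> (\<Union>n. Ts n) \<and> w \<in> T \<and> (\<exists>y\<in>T. f y < f w)"
    if w: "w \<in> (\<Union>n. Vs n)" "w \<noteq> v" for w
  proof -
    obtain i where i: "w \<in> Vs i" using w by blast
    have ex1: "\<exists>!T. T \<in> Ts (n + k) \<and> w \<in> T \<and> (\<exists>y\<in>T. f y < f w)" if "w \<in> Vs (n + k)" for k
      using level_farther[OF f that w(2)] .
    have "w \<in> Vs (n + i)" using mono_stage[of i "n + i"] i by auto
    then obtain T where T: "T \<in> Ts (n + i)" "w \<in> T" "\<exists>y\<in>T. f y < f w" using ex1 by blast
    have "T' = T" if T': "T' \<in> Ts j" "w \<in> T'" "\<exists>y\<in>T'. f y < f w" for T' j
    proof -
      obtain k where k: "w \<in> Vs (n + k)" "T \<in> Ts (n + k)" "T' \<in> Ts (n + k)"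
        using common[OF i T(1) T'(1)] by blast
      show ?thesis
        using ex1[OF k(1)] k(2,3) T(2,3) T'(2,3) by metis
    qed
    then show ?thesis using T by (intro ex1I[of _ T]) blast+
  qed
  moreover have "f v = 0" using level_root[OF f] .
  ultimately have "level_function (\<Union>n. Vs n) (\<Union>n. Ts n) v f"
    by (intro level_functionI)
  then show ?thesis by blast
qed

lemma triangle_space_limit: "triangle_space (\<Union>n. Vs n) (\<Union>n. Ts n)"
proof
  have "Vs 0 \<noteq> {}" using card_0 by auto
  then show "(\<Union>n. Vs n) \<noteq> {}" by blast
next
  fix T assume "T \<in> (\<Union>n. Ts n)"
  then show "T \<subseteq> (\<Union>n. Vs n)" "card T = 3" by (auto simp: triangles_def nsets_def)
next
  fix v assume "v \<in> (\<Union>n. Vs n)"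
  then show "\<exists>f. level_function (\<Union>n. Vs n) (\<Union>n. Ts n) v f" using level_limit by blast
  obtain n where n: "v \<in> Vs n" "card (triangles_at n v) = 2"
    using \<open>v \<in> _\<close> eventually_two by blast
  \<comment> \<open>Stage \<open>max m n\<close> contains the triangles of stage \<open>m\<close>,
    and those through \<open>v\<close> are still the two of stage \<open>n\<close>.\<close>
  have "triangles_at m v \<subseteq> triangles_at n v" for m
    using at_complete[OF n, of "max m n"] mono_stage[of m "max m n"] by auto
  then have "{T \<in> (\<Union>n. Ts n). v \<in> T} = triangles_at n v" by blast
  then show "card {T \<in> (\<Union>n. Ts n). v \<in> T} = 2" using n(2) by simp
qed

lemma edges_limit: "(\<Union>n. Es n) = triangle_space.edges (\<Union>n. Ts n)"
  unfolding triangle_space.edges_def[OF triangle_space_limit] using edges_stage by blast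

end

theorem proposition3p10:
  fixes V :: "'a set" and E :: "'a set set"
  assumes "linked_triangle_graph V E"
  shows "distance_regular V E (\<lambda>i. if i = 0 then 4 else 2) (\<lambda>i. 1)
       \<and> graph_diam V E = \<infinity>"
proof -
  obtain Vs Es where stages: "linked_triangle_stages Vs Es"
    and V: "V = (\<Union>n. Vs n)" and E: "E = (\<Union>n. Es n)"
    using assms unfolding linked_triangle_graph_def linked_triangle_stages_def by blast
  interpret linked_triangle_stages Vs Es by (rule stages)
  interpret triangle_space "\<Union>n. Vs n" "\<Union>n. Ts n" by (rule triangle_space_limit)
  show ?thesis
    unfolding V E edges_limit using distance_regular_edges graph_diam_edges by blast
qed

end
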